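(* Let $R$ be a (commutative) Noetherian domain, let $a$ be an ideal of $R$, and let $0\to L\stackrel{f}{\to}M\stackrel{g}{\to}N\to 0$ be an e-exact sequence of $R$-modules and $R$-homomorphisms. Then $$0\to\Gamma_a(L)\stackrel{\Gamma_a(f)}{\longrightarrow}\Gamma_a(M)\stackrel{\Gamma_a(g)}{\longrightarrow}\Gamma_a(N)$$ is an e-exact sequence. Furthermore, if $N$ is a torsion-free module, then $\Gamma_a$ is e-exact on this sequence, i.e. $0\to\Gamma_a(L)\stackrel{\Gamma_a(f)}{\longrightarrow}\Gamma_a(M)\stackrel{\Gamma_a(g)}{\longrightarrow}\Gamma_a(N)\to 0$ is e-exact.
   Context: All modules are unitary. A submodule $N$ of $M$ is essential, written $N\leqslant_e M$, if it has nonzero intersection with every nonzero submodule of $M$. A sequence $\cdots\to N_{i-1}\stackrel{f_{i-1}}{\to}N_i\stackrel{f_i}{\to}N_{i+1}\to\cdots$ is e-exact if $\operatorname{Im}(f_{i-1})\leqslant_e\operatorname{Ker}(f_i)$ at every (interior) term $N_i$. In particular $0\to L\stackrel{f}{\to}M\stackrel{g}{\to}N\to 0$ is e-exact iff $\operatorname{Ker}f=0$, $\operatorname{Im}f\leqslant_e\operatorname{Ker}g$ and $\operatorname{Im}g\leqslant_e N$. $\Gamma_a$ is the $a$-torsion functor: $\Gamma_a(M)=\{m\in M: a^nm=0\text{ for some }n\in\mathbb{N}\}$, with $\Gamma_a(f)$ the restriction of $f$. A module $M$ is torsion-free if $rm=0$ with $r\in R$, $m\in M$ implies $r=0$ or $m=0$.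 *)

theory Defs
  imports "HOL-Algebra.Algebra"
begin

text \<open>Modules are those of \<open>HOL-Algebra\<close>: unitary, over a commutative ring, with a carrier set.
  A submodule \<open>K\<close> of \<open>M\<close> is a set; the module it carries is \<open>M\<lparr>carrier := K\<rparr>\<close>.\<close>

definition mod_hom ::
    "('a, 'r) ring_scheme \<Rightarrow> ('a, 'm, 'x) module_scheme \<Rightarrow> ('a, 'n, 'y) module_scheme
      \<Rightarrow> ('m \<Rightarrow> 'n) set"
  where "mod_hom R M N =
    {h \<in> hom (add_monoid M) (add_monoid N).
       \<forall>r\<in>carrier R. \<forall>x\<in>carrier M. h (r \<odot>\<^bsub>M\<^esub> x) = r \<odot>\<^bsub>N\<^esub> h x}"

definition essential_submodule ::
    "('a, 'r) ring_scheme \<Rightarrow> 'm set \<Rightarrow> ('a, 'm, 'x) module_scheme \<Rightarrow> bool"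
  where "essential_submodule R H M \<longleftrightarrow>
    submodule H R M \<and>
    (\<forall>K. submodule K R M \<and> K \<noteq> {\<zero>\<^bsub>M\<^esub>} \<longrightarrow> H \<inter> K \<noteq> {\<zero>\<^bsub>M\<^esub>})"

text \<open>E-exactness at the middle term \<open>B\<close> of \<open>A \<rightarrow> B \<rightarrow> C\<close>. A sequence is e-exact if it is so at
  every interior term; as the terms may have different types, the sequences that are needed
  are spelled out as conjunctions below.\<close>

definition e_exact_at ::
    "('a, 'r) ring_scheme \<Rightarrow> ('a, 'l, 'x) module_scheme \<Rightarrow> ('l \<Rightarrow> 'm)
      \<Rightarrow> ('a, 'm, 'y) module_scheme \<Rightarrow> ('m \<Rightarrow> 'n) \<Rightarrow> ('a, 'n, 'z) module_scheme \<Rightarrow> bool"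
  where "e_exact_at R A f B g C \<longleftrightarrow>
    module R A \<and> module R B \<and> module R C \<and> f \<in> mod_hom R A B \<and> g \<in> mod_hom R B C \<and>
    essential_submodule R (f ` carrier A) (B\<lparr>carrier := a_kernel B C g\<rparr>)"

definition zero_module :: "('a, unit) module"
  where "zero_module =
    \<lparr>carrier = {()}, monoid.mult = (\<lambda>_ _. ()), one = (), ring.zero = (), ring.add = (\<lambda>_ _. ()),
     smult = (\<lambda>_ _. ())\<rparr>"

text \<open>\<open>0 \<rightarrow> L \<rightarrow> M \<rightarrow> N\<close>: the interior terms are \<open>L\<close> and \<open>M\<close>.\<close>

definition left_e_exact ::
    "('a, 'r) ring_scheme \<Rightarrow> ('a, 'l, 'x) module_scheme \<Rightarrow> ('l \<Rightarrow> 'm)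
      \<Rightarrow> ('a, 'm, 'y) module_scheme \<Rightarrow> ('m \<Rightarrow> 'n) \<Rightarrow> ('a, 'n, 'z) module_scheme \<Rightarrow> bool"
  where "left_e_exact R L f M g N \<longleftrightarrow>
    e_exact_at R zero_module (\<lambda>_. \<zero>\<^bsub>L\<^esub>) L f M \<and> e_exact_at R L f M g N"

text \<open>\<open>0 \<rightarrow> L \<rightarrow> M \<rightarrow> N \<rightarrow> 0\<close>: the interior terms are \<open>L\<close>, \<open>M\<close> and \<open>N\<close>.\<close>

definition short_e_exact ::
    "('a, 'r) ring_scheme \<Rightarrow> ('a, 'l, 'x) module_scheme \<Rightarrow> ('l \<Rightarrow> 'm)
      \<Rightarrow> ('a, 'm, 'y) module_scheme \<Rightarrow> ('m \<Rightarrow> 'n) \<Rightarrow> ('a, 'n, 'z) module_scheme \<Rightarrow> bool"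
  where "short_e_exact R L f M g N \<longleftrightarrow>
    e_exact_at R zero_module (\<lambda>_. \<zero>\<^bsub>L\<^esub>) L f M \<and> e_exact_at R L f M g N \<and>
    e_exact_at R M g N (\<lambda>_. ()) zero_module"

text \<open>In the multiplicative monoid of \<^term>\<open>ideals_set R\<close>, the power \<open>I [^] n\<close> is the usual power
  of ideals, with \<open>I [^] 0 = carrier R\<close>.\<close>

definition Gamma ::
    "('a, 'r) ring_scheme \<Rightarrow> 'a set \<Rightarrow> ('a, 'm, 'x) module_scheme \<Rightarrow> ('a, 'm, 'x) module_scheme"
  where "Gamma R I M =
    M\<lparr>carrier := {m \<in> carrier M. \<exists>n::nat. \<forall>r \<in> I [^]\<^bsub>ideals_set R\<^esub> n. r \<odot>\<^bsub>M\<^esub> m = \<zero>\<^bsub>M\<^esub>}\<rparr>"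

definition Gamma_map ::
    "('a, 'r) ring_scheme \<Rightarrow> 'a set \<Rightarrow> ('a, 'm, 'x) module_scheme \<Rightarrow> ('m \<Rightarrow> 'n) \<Rightarrow> ('m \<Rightarrow> 'n)"
  where "Gamma_map R I M h = restrict h (carrier (Gamma R I M))"

definition torsion_free_module ::
    "('a, 'r) ring_scheme \<Rightarrow> ('a, 'm, 'x) module_scheme \<Rightarrow> bool"
  where "torsion_free_module R M \<longleftrightarrow>
    (\<forall>r\<in>carrier R. \<forall>m\<in>carrier M. r \<odot>\<^bsub>M\<^esub> m = \<zero>\<^bsub>M\<^esub> \<longrightarrow> r = \<zero>\<^bsub>R\<^esub> \<or> m = \<zero>\<^bsub>M\<^esub>)"

end

theory Submission
  imports Defs
begin

text \<open>Intersecting an essential extension \<open>H \<le> S\<close> with a submodule \<open>T\<close> gives an essential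
  extension, so e-exactness passes to submodules as soon as the image stays the trace of the old
  image. For \<open>\<Gamma>\<^sub>\<aa>\<close> this trace condition holds at \<open>M\<close> because \<open>f\<close> is injective, hence reflects
  annihilation by \<open>\<aa>\<^sup>n\<close>. At \<open>N\<close> torsion-free it holds because \<open>\<Gamma>\<^sub>\<aa>\<close> is the identity if \<open>\<aa> = 0\<close>, and
  otherwise \<open>\<Gamma>\<^sub>\<aa>(N) = 0\<close>, as the powers of \<open>\<aa>\<close> are nonzero in a domain.\<close>

section \<open>Submodules and essential extensions inside a fixed module\<close>

lemma (in module) submodule_of_submodule_iff:
  assumes "submodule S R M"
  shows "submodule K R (M\<lparr>carrier := S\<rparr>) \<longleftrightarrow> submodule K R M \<and> K \<subseteq> S"
proof -
  interpret S: module R "M\<lparr>carrier := S\<rparr>"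
    using submodule.submodule_is_module[OF assms module_axioms] .
  have "submodule K R M \<and> K \<subseteq> S" if K: "submodule K R (M\<lparr>carrier := S\<rparr>)"
  proof -
    have "K \<subseteq> S"
      using S.submoduleE(1)[OF K] by simp
    \<comment> \<open>A second carrier update overwrites the first, so \<open>K\<close> carries the
      same module inside \<open>S\<close> as inside \<open>M\<close>. Both directions thus reduce to
      \<open>K\<close> being a module on a subset of the carrier.\<close>
    moreover have "module R (M\<lparr>carrier := K\<rparr>)"
      using submodule.submodule_is_module[OF K S.module_axioms] by simp
    ultimately show ?thesis
      using module_incl_imp_submodule submoduleE(1)[OF assms] by blast
  qed
  moreover have "submodule K R (M\<lparr>carrier := S\<rparr>)" if K: "submodule K R M" "K \<subseteq> S"
    using S.module_incl_imp_submodule[of K] K(2)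
      submodule.submodule_is_module[OF K(1) module_axioms] by simp
  ultimately show ?thesis by blast
qed

lemma (in module) submodule_zero_closed:
  assumes "submodule K R M"
  shows "\<zero>\<^bsub>M\<^esub> \<in> K"
  using subgroup.one_closed[OF submodule.axioms(1)[OF assms]] by simp

lemma (in module) submodule_Int:
  assumes "submodule S R M" and "submodule T R M"
  shows "submodule (S \<inter> T) R M"
  using submoduleE(1,3-5)[OF assms(1)] submoduleE(3-5)[OF assms(2)]
    submodule_zero_closed[OF assms(1)] submodule_zero_closed[OF assms(2)]
  by (intro submoduleI) auto

text \<open>Any nonzero \<open>K\<close> inside \<open>S \<inter> T\<close> is a test submodule for
  \<open>H\<close> in \<open>S\<close>, and \<open>H \<inter> K\<close> already lies in
  \<open>T\<close>, so cutting \<open>H\<close> down to \<open>T\<close> loses nothing.\<close>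

lemma (in module) essential_submodule_Int:
  assumes S: "submodule S R M" and T: "submodule T R M"
    and H: "essential_submodule R H (M\<lparr>carrier := S\<rparr>)"
  shows "essential_submodule R (H \<inter> T) (M\<lparr>carrier := S \<inter> T\<rparr>)"
proof -
  have "submodule H R M" "H \<subseteq> S"
    using H by (auto simp: essential_submodule_def submodule_of_submodule_iff[OF S])
  moreover have "H \<inter> T \<inter> K \<noteq> {\<zero>\<^bsub>M\<^esub>}"
    if "submodule K R M" "K \<subseteq> S \<inter> T" "K \<noteq> {\<zero>\<^bsub>M\<^esub>}" for K
  proof -
    have "H \<inter> K \<noteq> {\<zero>\<^bsub>M\<^esub>}"
      using H that by (auto simp: essential_submodule_def submodule_of_submodule_iff[OF S])
    moreover have "H \<inter> T \<inter> K = H \<inter> K"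
      using that by blast
    ultimately show ?thesis by simp
  qed
  ultimately show ?thesis
    using submodule_Int[OF S T] submodule_Int[OF _ T]
    by (auto simp: essential_submodule_def submodule_of_submodule_iff)
qed

section \<open>Homomorphisms, kernels and restriction of e-exactness\<close>

lemma mod_homD:
  assumes "h \<in> mod_hom R M N"
  shows "x \<in> carrier M \<Longrightarrow> h x \<in> carrier N"
    and "x \<in> carrier M \<Longrightarrow> y \<in> carrier M \<Longrightarrow> h (x \<oplus>\<^bsub>M\<^esub> y) = h x \<oplus>\<^bsub>N\<^esub> h y"
    and "r \<in> carrier R \<Longrightarrow> x \<in> carrier M \<Longrightarrow> h (r \<odot>\<^bsub>M\<^esub> x) = r \<odot>\<^bsub>N\<^esub> h x"
  using assms by (auto simp: mod_hom_def hom_def)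

lemma mod_hom_zero:
  assumes "module R M" "module R N" "h \<in> mod_hom R M N"
  shows "h \<zero>\<^bsub>M\<^esub> = \<zero>\<^bsub>N\<^esub>"
proof -
  interpret M: module R M by fact
  interpret N: module R N by fact
  \<comment> \<open>\<open>hom\<close> asks only for compatibility with addition, so zero is reached
    through linearity at the scalar zero.\<close>
  have "h (\<zero>\<^bsub>R\<^esub> \<odot>\<^bsub>M\<^esub> \<zero>\<^bsub>M\<^esub>) = \<zero>\<^bsub>R\<^esub> \<odot>\<^bsub>N\<^esub> h \<zero>\<^bsub>M\<^esub>"
    using mod_homD(3)[OF assms(3)] by blast
  then show ?thesis
    using mod_homD(1)[OF assms(3)] by simp
qed

lemma submodule_a_kernel:
  assumes "module R M" "module R N" "h \<in> mod_hom R M N"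
  shows "submodule (a_kernel M N h) R M"
proof -
  interpret M: module R M by fact
  interpret N: module R N by fact
  note h = mod_homD[OF assms(3)] mod_hom_zero[OF assms]
  have "h (\<ominus>\<^bsub>M\<^esub> x) = \<zero>\<^bsub>N\<^esub>" if "x \<in> carrier M" "h x = \<zero>\<^bsub>N\<^esub>" for x
  proof -
    have "h (\<ominus>\<^bsub>M\<^esub> x) = h ((\<ominus>\<^bsub>R\<^esub> \<one>\<^bsub>R\<^esub>) \<odot>\<^bsub>M\<^esub> x)"
      using that by (simp add: M.smult_l_minus)
    also have "\<dots> = \<zero>\<^bsub>N\<^esub>"
      using that by (simp add: h)
    finally show ?thesis .
  qed
  then show ?thesis
    by (intro M.submoduleI) (auto simp: a_kernel_def' h)
qed

text \<open>The kernel of the restricted map is the trace of the old kernel on \<open>B'\<close>,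
  and \<open>image\<close> says the same of the images, so \<open>essential_submodule_Int\<close>
  applies. The maps \<open>f'\<close> and \<open>g'\<close> need to agree with \<open>f\<close> and
  \<open>g\<close> only on the submodules, because \<open>Gamma_map\<close> is
  \<open>undefined\<close> elsewhere.\<close>

lemma e_exact_at_submodules:
  assumes ex: "e_exact_at R A f B g C"
    and A': "submodule A' R A" and B': "submodule B' R B" and C': "submodule C' R C"
    and image: "f ` A' = f ` carrier A \<inter> B'" and g_closed: "g ` B' \<subseteq> C'"
    and f': "\<And>x. x \<in> A' \<Longrightarrow> f' x = f x" and g': "\<And>x. x \<in> B' \<Longrightarrow> g' x = g x"
  shows "e_exact_at R (A\<lparr>carrier := A'\<rparr>) f' (B\<lparr>carrier := B'\<rparr>) g' (C\<lparr>carrier := C'\<rparr>)"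
proof -
  have mods: "module R A" "module R B" "module R C"
    and homs: "f \<in> mod_hom R A B" "g \<in> mod_hom R B C"
    and ess: "essential_submodule R (f ` carrier A) (B\<lparr>carrier := a_kernel B C g\<rparr>)"
    using ex by (auto simp: e_exact_at_def)
  interpret A: module R A by fact
  interpret B: module R B by fact
  interpret C: module R C by fact
  note subA = A.submoduleE[OF A'] and subB = B.submoduleE[OF B']
  have "f' \<in> mod_hom R (A\<lparr>carrier := A'\<rparr>) (B\<lparr>carrier := B'\<rparr>)"
    using image subA(1,4,5) mod_homD[OF homs(1)] f'
    by (auto simp: mod_hom_def hom_def subset_eq)
  moreover have "g' \<in> mod_hom R (B\<lparr>carrier := B'\<rparr>) (C\<lparr>carrier := C'\<rparr>)"
    using g_closed subB(1,4,5) mod_homD[OF homs(2)] g'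
    by (auto simp: mod_hom_def hom_def subset_eq)
  moreover have "f' ` A' = f ` carrier A \<inter> B'"
    using image f' by (metis image_cong)
  moreover have "a_kernel (B\<lparr>carrier := B'\<rparr>) (C\<lparr>carrier := C'\<rparr>) g' = a_kernel B C g \<inter> B'"
    using subB(1) g' by (auto simp: a_kernel_def')
  ultimately show ?thesis
    using B.essential_submodule_Int[OF submodule_a_kernel[OF mods(2,3) homs(2)] B' ess]
      submodule.submodule_is_module[OF A' mods(1)] submodule.submodule_is_module[OF B' mods(2)]
      submodule.submodule_is_module[OF C' mods(3)]
    by (simp add: e_exact_at_def)
qed

text \<open>The zero submodule is essential in the kernel of \<open>f\<close>; testing this against
  the kernel itself forces the kernel to vanish.\<close>

lemma mod_hom_inj_on:
  assumes ex: "e_exact_at R zero_module (\<lambda>_. \<zero>\<^bsub>L\<^esub>) L f M"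
  shows "inj_on f (carrier L)"
proof -
  have mods: "module R L" "module R M" and f: "f \<in> mod_hom R L M"
    and ess: "essential_submodule R {\<zero>\<^bsub>L\<^esub>} (L\<lparr>carrier := a_kernel L M f\<rparr>)"
    using ex by (auto simp: e_exact_at_def zero_module_def)
  interpret L: module R L by fact
  interpret M: module R M by fact
  note f_simps = mod_homD[OF f]
  have ker: "submodule (a_kernel L M f) R L"
    using submodule_a_kernel[OF mods f] .
  then have "submodule (a_kernel L M f) R (L\<lparr>carrier := a_kernel L M f\<rparr>)"
    by (simp add: L.submodule_of_submodule_iff)
  then have trivial: "a_kernel L M f = {\<zero>\<^bsub>L\<^esub>}"
    using ess L.submodule_zero_closed[OF ker]
    by (auto simp: essential_submodule_def)
  show ?thesis
  proof (rule inj_onI)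
    fix x y assume xy: "x \<in> carrier L" "y \<in> carrier L" "f x = f y"
    have "f (\<ominus>\<^bsub>L\<^esub> y) = f ((\<ominus>\<^bsub>R\<^esub> \<one>\<^bsub>R\<^esub>) \<odot>\<^bsub>L\<^esub> y)"
      using xy by (simp add: L.smult_l_minus)
    also have "\<dots> = \<ominus>\<^bsub>M\<^esub> f y"
      using xy by (simp add: f_simps M.smult_l_minus)
    finally have "f (x \<oplus>\<^bsub>L\<^esub> \<ominus>\<^bsub>L\<^esub> y) = \<zero>\<^bsub>M\<^esub>"
      using xy by (simp add: f_simps M.r_neg)
    then have "x \<oplus>\<^bsub>L\<^esub> \<ominus>\<^bsub>L\<^esub> y \<in> a_kernel L M f"
      using xy by (simp add: a_kernel_def')
    then have "x \<oplus>\<^bsub>L\<^esub> \<ominus>\<^bsub>L\<^esub> y = \<zero>\<^bsub>L\<^esub>"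
      using trivial by simp
    then show "x = y"
      using xy by (metis L.a_inv_closed L.minus_equality L.minus_minus)
  qed
qed

section \<open>Powers of an ideal\<close>

lemma (in cring) ideal_pow_ideal:
  assumes "ideal I R"
  shows "ideal (I [^]\<^bsub>ideals_set R\<^esub> (n::nat)) R"
proof -
  interpret ideals: comm_monoid "ideals_set R"
    by (rule ideals_set_is_comm_monoid)
  show ?thesis
    using ideals.nat_pow_closed[of I n] assms by (simp add: ideals_set_def)
qed

lemma (in cring) ideal_pow_antimono:
  assumes "ideal I R" "m \<le> (n::nat)"
  shows "I [^]\<^bsub>ideals_set R\<^esub> n \<subseteq> I [^]\<^bsub>ideals_set R\<^esub> m"
proof -
  interpret ideals: comm_monoid "ideals_set R"
    by (rule ideals_set_is_comm_monoid)
  \<comment> \<open>Splitting off the \<open>m\<close>-th power suffices, as a product of ideals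
    lies in each factor.\<close>
  have "I [^]\<^bsub>ideals_set R\<^esub> n =
      (I [^]\<^bsub>ideals_set R\<^esub> m) \<cdot>\<^bsub>R\<^esub> (I [^]\<^bsub>ideals_set R\<^esub> (n - m))"
    using ideals.nat_pow_mult[of I m "n - m"] assms by (simp add: ideals_set_def)
  then show ?thesis
    using ideal_prod_inter[OF ideal_pow_ideal ideal_pow_ideal] assms(1) by auto
qed

text \<open>This lets annihilation by a power of the ideal be tested on the power of a single
  element.\<close>

lemma (in cring) pow_mem_ideal_pow:
  assumes "ideal I R" "r \<in> I"
  shows "r [^] (n::nat) \<in> I [^]\<^bsub>ideals_set R\<^esub> n"
proof (induction n)
  case 0
  then show ?case by (simp add: ideals_set_def)
next
  case (Suc n)
  then show ?case
    using assms(2) by (simp add: ideals_set_def ideal_prod.prod)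
qed

section \<open>The torsion submodule and its behaviour under homomorphisms\<close>

lemma mem_Gamma_iff:
  "m \<in> carrier (Gamma R I M) \<longleftrightarrow>
    m \<in> carrier M \<and> (\<exists>n::nat. \<forall>r \<in> I [^]\<^bsub>ideals_set R\<^esub> n. r \<odot>\<^bsub>M\<^esub> m = \<zero>\<^bsub>M\<^esub>)"
  by (simp add: Gamma_def)

lemma Gamma_eq: "Gamma R I M = M\<lparr>carrier := carrier (Gamma R I M)\<rparr>"
  by (simp add: Gamma_def)

lemma zero_Gamma: "\<zero>\<^bsub>Gamma R I M\<^esub> = \<zero>\<^bsub>M\<^esub>"
  by (simp add: Gamma_def)

lemma (in module) submodule_Gamma:
  assumes I: "ideal I R"
  shows "submodule (carrier (Gamma R I M)) R M"
proof (rule submoduleI)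
  show "carrier (Gamma R I M) \<subseteq> carrier M"
    by (auto simp: mem_Gamma_iff)
  have pow_carr: "r \<in> carrier R" if "r \<in> I [^]\<^bsub>ideals_set R\<^esub> n" for r and n :: nat
    using ideal.Icarr[OF R.ideal_pow_ideal[OF I] that] .
  then show "\<zero>\<^bsub>M\<^esub> \<in> carrier (Gamma R I M)"
    by (auto simp: mem_Gamma_iff)
  show "\<ominus>\<^bsub>M\<^esub> x \<in> carrier (Gamma R I M)" if "x \<in> carrier (Gamma R I M)" for x
    using that pow_carr by (fastforce simp: mem_Gamma_iff smult_r_minus)
  show "x \<oplus>\<^bsub>M\<^esub> y \<in> carrier (Gamma R I M)"
    if x: "x \<in> carrier (Gamma R I M)" and y: "y \<in> carrier (Gamma R I M)" for x y
  proof -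
    obtain m n :: nat where
      m: "\<And>r. r \<in> I [^]\<^bsub>ideals_set R\<^esub> m \<Longrightarrow> r \<odot>\<^bsub>M\<^esub> x = \<zero>\<^bsub>M\<^esub>" and
      n: "\<And>r. r \<in> I [^]\<^bsub>ideals_set R\<^esub> n \<Longrightarrow> r \<odot>\<^bsub>M\<^esub> y = \<zero>\<^bsub>M\<^esub>"
      using x y by (auto simp: mem_Gamma_iff)
    \<comment> \<open>Higher powers of \<open>I\<close> are smaller, so the larger exponent
      annihilates both summands.\<close>
    have "r \<odot>\<^bsub>M\<^esub> (x \<oplus>\<^bsub>M\<^esub> y) = \<zero>\<^bsub>M\<^esub>" if "r \<in> I [^]\<^bsub>ideals_set R\<^esub> (max m n)" for r
    proof -
      have "r \<in> I [^]\<^bsub>ideals_set R\<^esub> m" "r \<in> I [^]\<^bsub>ideals_set R\<^esub> n"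
        using that R.ideal_pow_antimono[OF I] by (meson max.cobounded1 max.cobounded2 subsetD)+
      then show ?thesis
        using m n x y pow_carr by (simp add: mem_Gamma_iff smult_r_distr)
    qed
    then show ?thesis
      using x y by (auto simp: mem_Gamma_iff)
  qed
  show "a \<odot>\<^bsub>M\<^esub> x \<in> carrier (Gamma R I M)"
    if a: "a \<in> carrier R" and x: "x \<in> carrier (Gamma R I M)" for a x
  proof -
    obtain n :: nat where n: "\<And>r. r \<in> I [^]\<^bsub>ideals_set R\<^esub> n \<Longrightarrow> r \<odot>\<^bsub>M\<^esub> x = \<zero>\<^bsub>M\<^esub>"
      and x': "x \<in> carrier M"
      using x by (auto simp: mem_Gamma_iff)
    have "r \<odot>\<^bsub>M\<^esub> (a \<odot>\<^bsub>M\<^esub> x) = \<zero>\<^bsub>M\<^esub>" if r: "r \<in> I [^]\<^bsub>ideals_set R\<^esub> n" for r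
    proof -
      have "r \<odot>\<^bsub>M\<^esub> (a \<odot>\<^bsub>M\<^esub> x) = a \<odot>\<^bsub>M\<^esub> (r \<odot>\<^bsub>M\<^esub> x)"
        using a x' pow_carr[OF r] by (metis R.m_comm smult_assoc1)
      then show ?thesis
        using n[OF r] a by simp
    qed
    then show ?thesis
      using a x' by (auto simp: mem_Gamma_iff)
  qed
qed

text \<open>Linearity turns \<open>r\<close> acting on \<open>h x\<close> into \<open>h\<close> of
  \<open>r\<close> acting on \<open>x\<close>, so the exponent found for \<open>x\<close> also
  serves for \<open>h x\<close>.\<close>

lemma mod_hom_Gamma_closed:
  assumes I: "ideal I R" and mods: "module R M" "module R N" and h: "h \<in> mod_hom R M N"
    and x: "x \<in> carrier (Gamma R I M)"
  shows "h x \<in> carrier (Gamma R I N)"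
proof -
  interpret M: module R M by fact
  obtain n :: nat where n: "\<And>r. r \<in> I [^]\<^bsub>ideals_set R\<^esub> n \<Longrightarrow> r \<odot>\<^bsub>M\<^esub> x = \<zero>\<^bsub>M\<^esub>"
    and x': "x \<in> carrier M"
    using x by (auto simp: mem_Gamma_iff)
  have "r \<odot>\<^bsub>N\<^esub> h x = \<zero>\<^bsub>N\<^esub>" if r: "r \<in> I [^]\<^bsub>ideals_set R\<^esub> n" for r
  proof -
    have "r \<odot>\<^bsub>N\<^esub> h x = h (r \<odot>\<^bsub>M\<^esub> x)"
      using mod_homD(3)[OF h ideal.Icarr[OF M.ideal_pow_ideal[OF I] r] x'] by simp
    then show ?thesis
      using n[OF r] mod_hom_zero[OF mods h] by simp
  qed
  then show ?thesis
    using mod_homD(1)[OF h x'] by (auto simp: mem_Gamma_iff)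
qed

lemma image_Gamma_inj:
  assumes I: "ideal I R" and mods: "module R M" "module R N" and h: "h \<in> mod_hom R M N"
    and inj: "inj_on h (carrier M)"
  shows "h ` carrier (Gamma R I M) = h ` carrier M \<inter> carrier (Gamma R I N)"
proof -
  interpret M: module R M by fact
  have pow_carr: "r \<in> carrier R" if "r \<in> I [^]\<^bsub>ideals_set R\<^esub> n" for r and n :: nat
    using ideal.Icarr[OF M.ideal_pow_ideal[OF I] that] .
  have "x \<in> carrier (Gamma R I M)"
    if x: "x \<in> carrier M" and hx: "h x \<in> carrier (Gamma R I N)" for x
  proof -
    obtain n :: nat where n: "\<And>r. r \<in> I [^]\<^bsub>ideals_set R\<^esub> n \<Longrightarrow> r \<odot>\<^bsub>N\<^esub> h x = \<zero>\<^bsub>N\<^esub>"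
      using hx by (auto simp: mem_Gamma_iff)
    \<comment> \<open>The exponent for \<open>h x\<close> works for \<open>x\<close>: the scalar
      multiple and zero have the same image under the injective \<open>h\<close>.\<close>
    have "r \<odot>\<^bsub>M\<^esub> x = \<zero>\<^bsub>M\<^esub>" if r: "r \<in> I [^]\<^bsub>ideals_set R\<^esub> n" for r
    proof (rule inj_onD[OF inj])
      show "h (r \<odot>\<^bsub>M\<^esub> x) = h \<zero>\<^bsub>M\<^esub>"
        using n[OF r] pow_carr[OF r] x by (simp add: mod_homD[OF h] mod_hom_zero[OF mods h])
    qed (use pow_carr[OF r] x in simp_all)
    then show ?thesis
      using x by (auto simp: mem_Gamma_iff)
  qed
  moreover have "carrier (Gamma R I M) \<subseteq> carrier M"
    by (auto simp: mem_Gamma_iff)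
  ultimately show ?thesis
    using mod_hom_Gamma_closed[OF I mods h] by blast
qed

lemma (in module) Gamma_zero_ideal: "carrier (Gamma R {\<zero>} M) = carrier M"
proof -
  \<comment> \<open>The witness is exponent 1; the power with exponent 0 is all of
    \<open>carrier R\<close>, which annihilates only zero.\<close>
  have "{\<zero>} [^]\<^bsub>ideals_set R\<^esub> (1::nat) = {\<zero>}"
    using monoid.nat_pow_eone[of "ideals_set R" "{\<zero>}"] R.zeroideal
      comm_monoid.axioms(1)[OF R.ideals_set_is_comm_monoid]
    by (simp add: ideals_set_def)
  then have "\<forall>r \<in> {\<zero>} [^]\<^bsub>ideals_set R\<^esub> (1::nat). r \<odot>\<^bsub>M\<^esub> m = \<zero>\<^bsub>M\<^esub>" if "m \<in> carrier M" for m
    using that by simp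
  then show ?thesis
    unfolding set_eq_iff mem_Gamma_iff by blast
qed

text \<open>Fix a nonzero \<open>r\<close> in \<open>I\<close>. Every power of \<open>r\<close> is
  nonzero in a domain and lies in the corresponding power of \<open>I\<close>, so it annihilates a
  torsion element, which must then be zero.\<close>

lemma (in module) Gamma_torsion_free:
  assumes "domain R" and I: "ideal I R" "I \<noteq> {\<zero>}" and tf: "torsion_free_module R M"
  shows "carrier (Gamma R I M) = {\<zero>\<^bsub>M\<^esub>}"
proof -
  interpret domain R by fact
  obtain r where r: "r \<in> I" "r \<noteq> \<zero>"
    using I additive_subgroup.zero_closed[OF ideal.axioms(1)[OF I(1)]] by auto
  have r_carr: "r \<in> carrier R"
    using ideal.Icarr[OF I(1) r(1)] .
  have nonzero: "r [^] n \<noteq> \<zero>" for n :: nat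
    by (induction n) (use r r_carr integral in auto)
  have "m = \<zero>\<^bsub>M\<^esub>" if m: "m \<in> carrier (Gamma R I M)" for m
  proof -
    obtain n :: nat where "r [^] n \<odot>\<^bsub>M\<^esub> m = \<zero>\<^bsub>M\<^esub>" and "m \<in> carrier M"
      using m R.pow_mem_ideal_pow[OF I(1) r(1)] by (auto simp: mem_Gamma_iff)
    then show ?thesis
      using tf nonzero r_carr unfolding torsion_free_module_def by (meson R.nat_pow_closed)
  qed
  then show ?thesis
    using submodule_zero_closed[OF submodule_Gamma[OF I(1)]] by blast
qed

section \<open>The torsion functor applied to a short e-exact sequence\<close>

lemma zero_module_carrier: "zero_module\<lparr>carrier := {()}\<rparr> = zero_module"
  and carrier_zero_module: "carrier zero_module = {()}"
  by (simp_all add: zero_module_def)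

theorem lemma3p1:
  fixes R :: "('a, 'r) ring_scheme"
    and L :: "('a, 'l, 'x) module_scheme"
    and M :: "('a, 'm, 'y) module_scheme"
    and N :: "('a, 'n, 'z) module_scheme"
    and f :: "'l \<Rightarrow> 'm" and g :: "'m \<Rightarrow> 'n"
    and \<aa> :: "'a set"
  assumes "noetherian_domain R"
    and "ideal \<aa> R"
    and "module R L" and "module R M" and "module R N"
    and "f \<in> mod_hom R L M" and "g \<in> mod_hom R M N"
    and "short_e_exact R L f M g N"
  shows "left_e_exact R (Gamma R \<aa> L) (Gamma_map R \<aa> L f)
      (Gamma R \<aa> M) (Gamma_map R \<aa> M g) (Gamma R \<aa> N) \<and>
    (torsion_free_module R N \<longrightarrow>
      short_e_exact R (Gamma R \<aa> L) (Gamma_map R \<aa> L f)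
        (Gamma R \<aa> M) (Gamma_map R \<aa> M g) (Gamma R \<aa> N))"
proof -
  let ?L = "carrier (Gamma R \<aa> L)" and ?M = "carrier (Gamma R \<aa> M)" and ?N = "carrier (Gamma R \<aa> N)"
  interpret noetherian_domain R by fact
  interpret L: module R L by fact
  interpret M: module R M by fact
  interpret N: module R N by fact
  have ex_L: "e_exact_at R zero_module (\<lambda>_. \<zero>\<^bsub>L\<^esub>) L f M" and ex_M: "e_exact_at R L f M g N"
    and ex_N: "e_exact_at R M g N (\<lambda>_. ()) zero_module"
    using assms(8) by (simp_all add: short_e_exact_def)
  interpret Z: module R zero_module
    using ex_L by (simp add: e_exact_at_def)
  \<comment> \<open>Viewing \<open>zero_module\<close> as a submodule of itself lets
    \<open>e_exact_at_submodules\<close> treat the end terms too; \<open>zero_module_carrier\<close>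
    then removes the trivial carrier update.\<close>
  have Z: "submodule {()} R zero_module"
    using Z.carrier_is_submodule by (simp add: carrier_zero_module)
  note subs = L.submodule_Gamma[OF assms(2)] M.submodule_Gamma[OF assms(2)]
    N.submodule_Gamma[OF assms(2)]
  have f_closed: "f ` ?L \<subseteq> ?M" and g_closed: "g ` ?M \<subseteq> ?N"
    using mod_hom_Gamma_closed[OF assms(2-4,6)] mod_hom_Gamma_closed[OF assms(2,4,5,7)]
    by (auto simp only: image_subset_iff)
  \<comment> \<open>At \<open>L\<close> the image is just zero, which lies in \<open>?L\<close>, so
    the trace condition is immediate.\<close>
  have "e_exact_at R zero_module (\<lambda>_. \<zero>\<^bsub>L\<^esub>) (Gamma R \<aa> L) (Gamma_map R \<aa> L f) (Gamma R \<aa> M)"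
    using e_exact_at_submodules[OF ex_L Z subs(1,2), of "\<lambda>_. \<zero>\<^bsub>L\<^esub>" "Gamma_map R \<aa> L f",
        folded Gamma_eq]
      f_closed L.submodule_zero_closed[OF subs(1)]
    by (simp add: zero_module_carrier carrier_zero_module Gamma_map_def)
  \<comment> \<open>At \<open>M\<close> the trace condition is \<open>image_Gamma_inj\<close>, with
    injectivity of \<open>f\<close> coming from e-exactness at \<open>L\<close>.\<close>
  moreover have "e_exact_at R (Gamma R \<aa> L) (Gamma_map R \<aa> L f) (Gamma R \<aa> M)
      (Gamma_map R \<aa> M g) (Gamma R \<aa> N)"
    using e_exact_at_submodules[OF ex_M subs, of "Gamma_map R \<aa> L f" "Gamma_map R \<aa> M g",
        folded Gamma_eq]
      g_closed image_Gamma_inj[OF assms(2,3,4,6) mod_hom_inj_on[OF ex_L]]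
    by (simp add: Gamma_map_def)
  moreover have "e_exact_at R (Gamma R \<aa> M) (Gamma_map R \<aa> M g) (Gamma R \<aa> N) (\<lambda>_. ()) zero_module"
    if tf: "torsion_free_module R N"
  proof -
    \<comment> \<open>This is the trace condition at \<open>N\<close>. For the zero ideal both
      torsion submodules are the whole modules; otherwise \<open>?N\<close> is zero and both sides
      reduce to it.\<close>
    have "g ` ?M = g ` carrier M \<inter> ?N"
    proof (cases "\<aa> = {\<zero>\<^bsub>R\<^esub>}")
      case True
      then show ?thesis
        using mod_homD(1)[OF assms(7)] by (auto simp: M.Gamma_zero_ideal N.Gamma_zero_ideal)
    next
      case False
      then have "?N = {\<zero>\<^bsub>N\<^esub>}"
        using N.Gamma_torsion_free[OF domain_axioms assms(2) _ tf] by simp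
      moreover have "\<zero>\<^bsub>N\<^esub> \<in> g ` ?M"
        using imageI[OF M.submodule_zero_closed[OF subs(2)], of g]
        unfolding mod_hom_zero[OF assms(4,5,7)] .
      moreover have "?M \<subseteq> carrier M"
        by (auto simp: mem_Gamma_iff)
      ultimately show ?thesis
        using g_closed by auto
    qed
    then show ?thesis
      using e_exact_at_submodules[OF ex_N subs(2,3) Z, where f' = "Gamma_map R \<aa> M g" and g' = "\<lambda>_. ()",
        folded Gamma_eq]
      by (simp add: zero_module_carrier Gamma_map_def image_subset_iff)
  qed
  \<comment> \<open>The zero map in the definitions is written with the zero of
    \<open>Gamma R \<aa> L\<close>; \<open>zero_Gamma\<close> identifies it with that of
    \<open>L\<close>.\<close>
  ultimately show ?thesis
    by (simp add: left_e_exact_def short_e_exact_def zero_Gamma)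
qed

end
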